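(* Let $f$ be a $C^r$ immersion of an $n$-dimensional $C^r$ manifold $X$ into an open subset $V$ of $\mathbb{R}^m$, and let $g:V\to\mathbb{R}^\ell$ be a $C^r$ mapping, where $\ell\ge2n$ and $r\ge2$. Set $$\Sigma=\{\pi\in\mathcal{L}(\mathbb{R}^m,\mathbb{R}^\ell)\mid (g+\pi)\circ f:X\to\mathbb{R}^\ell\text{ is not an immersion}\}.$$ Then, for any real number $s$ satisfying $$s>m\ell+(2n-\ell-1),$$ the set $\Sigma$ has $s$-dimensional Hausdorff measure zero in $\mathcal{L}(\mathbb{R}^m,\mathbb{R}^\ell)$.
   Context: All manifolds are without boundary and have a countable basis. $\mathcal{L}(\mathbb{R}^m,\mathbb{R}^\ell)$ is the space of all linear mappings $\mathbb{R}^m\to\mathbb{R}^\ell$, identified with the Euclidean space $(\mathbb{R}^m)^\ell$ in the obvious way. Here $(g+\pi)\circ f$ is the mapping $q\mapsto g(f(q))+\pi(f(q))$. Hausdorff measure: for a real number $s\geq 0$ and $B\subset\mathbb{R}^N$, the $s$-dimensional Hausdorff outer measure of $B$ is the number of points of $B$ if $s=0$, and for $s>0$ it is $\lim_{\delta\to0}\mathcal{H}^s_\delta(B)$, where $\mathcal{H}^s_\delta(B)=\inf\{\sum_{j=1}^\infty(\operatorname{diam}C_j)^s\mid B\subset\bigcup_{j=1}^\infty C_j,\ \operatorname{diam}C_j\le\delta\}$. A set has $s$-dimensional Hausdorff measure zero if this outer measure is $0$. *)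

theory Defs
  imports "HOL-Analysis.Analysis" "HOL-Library.Extended_Nat"
begin

text \<open>
  Meaningful for open \<open>S\<close>. For \<open>k = Suc j\<close> it says that \<open>f\<close> is differentiable on \<open>S\<close> and that
  each directional derivative (in particular each partial derivative) is of class C^j; continuity
  of the intermediate derivatives follows from their differentiability.
\<close>

primrec Ck_on :: "nat \<Rightarrow> 'a::euclidean_space set \<Rightarrow> ('a \<Rightarrow> 'b::euclidean_space) \<Rightarrow> bool" where
  "Ck_on 0 S f \<longleftrightarrow> continuous_on S f"
| "Ck_on (Suc k) S f \<longleftrightarrow>
     (\<forall>x\<in>S. f differentiable (at x)) \<and> (\<forall>v. Ck_on k S (\<lambda>x. frechet_derivative f (at x) v))"

text \<open>The order is an extended natural number, so that \<open>r = \<infinity>\<close> gives the smooth mappings.\<close>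

definition Cr_on :: "enat \<Rightarrow> 'a::euclidean_space set \<Rightarrow> ('a \<Rightarrow> 'b::euclidean_space) \<Rightarrow> bool" where
  "Cr_on r S f \<longleftrightarrow> (\<forall>k. enat k \<le> r \<longrightarrow> Ck_on k S f)"

text \<open>
  A chart is a pair \<open>(U, \<phi>)\<close>; only the values of \<open>\<phi>\<close> on its domain \<open>U\<close> are relevant.
\<close>

type_synonym ('x, 'e) chart = "'x set \<times> ('x \<Rightarrow> 'e)"

definition is_chart :: "'x topology \<Rightarrow> ('x, 'e::euclidean_space) chart \<Rightarrow> bool" where
  "is_chart X = (\<lambda>(U, \<phi>).
     openin X U \<and> open (\<phi> ` U) \<and> homeomorphic_map (subtopology X U) (top_of_set (\<phi> ` U)) \<phi>)"

definition Cr_related :: "enat \<Rightarrow> ('x, 'e::euclidean_space) chart \<Rightarrow> ('x, 'e) chart \<Rightarrow> bool" where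
  "Cr_related r = (\<lambda>(U, \<phi>) (W, \<psi>). Cr_on r (\<phi> ` (U \<inter> W)) (\<psi> \<circ> inv_into U \<phi>))"

text \<open>
  \<open>\<A>\<close> is a C^r atlas on \<open>X\<close>, not necessarily maximal. The dimension of the manifold is \<open>DIM('e)\<close>.
\<close>

definition Cr_manifold ::
    "enat \<Rightarrow> 'x topology \<Rightarrow> ('x, 'e::euclidean_space) chart set \<Rightarrow> bool" where
  "Cr_manifold r X \<A> \<longleftrightarrow>
     Hausdorff_space X \<and> second_countable X \<and>
     (\<forall>c\<in>\<A>. is_chart X c) \<and> (\<Union>c\<in>\<A>. fst c) = topspace X \<and>
     (\<forall>c\<in>\<A>. \<forall>d\<in>\<A>. Cr_related r c d)"

definition Cr_map ::
    "enat \<Rightarrow> ('x, 'e::euclidean_space) chart set \<Rightarrow> ('x \<Rightarrow> 'b::euclidean_space) \<Rightarrow> bool" where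
  "Cr_map r \<A> h \<longleftrightarrow> (\<forall>(U, \<phi>)\<in>\<A>. Cr_on r (\<phi> ` U) (h \<circ> inv_into U \<phi>))"

definition immersion ::
    "('x, 'e::euclidean_space) chart set \<Rightarrow> ('x \<Rightarrow> 'b::euclidean_space) \<Rightarrow> bool" where
  "immersion \<A> h \<longleftrightarrow>
     (\<forall>(U, \<phi>)\<in>\<A>. \<forall>q\<in>U. \<exists>D. ((h \<circ> inv_into U \<phi>) has_derivative D) (at (\<phi> q)) \<and> inj D)"

text \<open>
  Boundedness of the \<open>C j\<close> is part of having diameter at most \<open>\<delta>\<close>: the library's \<open>diameter\<close> is
  real-valued and has no meaning for unbounded sets. Only \<open>s > 0\<close> is of interest here, so that
  sets of diameter 0 contribute \<open>0 powr s = 0\<close>.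
\<close>

definition hausdorff_pre :: "real \<Rightarrow> real \<Rightarrow> 'a::metric_space set \<Rightarrow> ennreal" where
  "hausdorff_pre s \<delta> B =
     (INF C \<in> {C :: nat \<Rightarrow> 'a set. B \<subseteq> (\<Union>j. C j) \<and> (\<forall>j. bounded (C j) \<and> diameter (C j) \<le> \<delta>)}.
        \<Sum>j. ennreal (diameter (C j) powr s))"

text \<open>\<open>emeasure (count_space UNIV) B\<close> is the number of points of \<open>B\<close>, possibly infinite.\<close>

definition hausdorff_outer :: "real \<Rightarrow> 'a::metric_space set \<Rightarrow> ennreal" where
  "hausdorff_outer s B =
     (if s = 0 then emeasure (count_space UNIV) B
      else Lim (at_right 0) (\<lambda>\<delta>. hausdorff_pre s \<delta> B))"

end

theory Submission
  imports Defs
begin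

text \<open>
  In a chart with representative \<open>F\<close> of \<open>f\<close>, the map \<open>(g + \<pi>) \<circ> f\<close> fails to be an immersion at
  \<open>x\<close> iff \<open>(Dg(F x) + \<pi>) w = 0\<close> for some \<open>w = DF(x) v\<close> with \<open>v \<noteq> 0\<close>, and then \<open>w \<noteq> 0\<close>. After
  normalising one coordinate of \<open>v\<close> to 1, such a \<open>\<pi>\<close> is determined by \<open>x\<close>, \<open>v\<close> and all but one
  column of \<open>Dg(F x) + \<pi>\<close>, that is by \<open>2n - 1 + (m - 1)l\<close> real parameters. It depends on them in
  a locally Lipschitz way because \<open>f\<close> and \<open>g\<close> are C^2, and a locally Lipschitz image of a
  \<open>d\<close>-dimensional set is a null set for the \<open>s\<close>-dimensional Hausdorff measure whenever \<open>s > d\<close>.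
\<close>

subsection \<open>Hausdorff null sets\<close>

text \<open>Vanishing is asked at every scale \<open>\<delta>\<close> rather than in the limit:
  covering arguments can then stay at one fixed scale, and the limit in
  \<open>hausdorff_outer\<close> becomes that of a function eventually constant 0.\<close>

definition hausdorff_null :: "real \<Rightarrow> 'a::metric_space set \<Rightarrow> bool" where
  "hausdorff_null s B \<longleftrightarrow> (\<forall>\<delta>>0. hausdorff_pre s \<delta> B = 0)"

lemma hausdorff_outer_eq_0:
  assumes "hausdorff_null s B" "s \<noteq> 0"
  shows "hausdorff_outer s B = 0"
proof -
  have "((\<lambda>\<delta>. hausdorff_pre s \<delta> B) \<longlongrightarrow> 0) (at_right 0)"
    using assms(1) by (intro tendsto_eventually) (auto simp: hausdorff_null_def eventually_at_filter)
  thus ?thesis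
    using assms(2) by (auto simp: hausdorff_outer_def intro!: tendsto_Lim)
qed

lemma hausdorff_pre_le_suminf:
  assumes "B \<subseteq> (\<Union>j. C j)" "\<And>j. bounded (C j) \<and> diameter (C j) \<le> \<delta>"
  shows "hausdorff_pre s \<delta> B \<le> (\<Sum>j. ennreal (diameter (C j) powr s))"
  unfolding hausdorff_pre_def by (rule INF_lower) (use assms in auto)

lemma hausdorff_pre_mono:
  "A \<subseteq> B \<Longrightarrow> hausdorff_pre s \<delta> A \<le> hausdorff_pre s \<delta> B"
  unfolding hausdorff_pre_def by (rule INF_superset_mono) auto

lemma hausdorff_null_subset:
  "hausdorff_null s B \<Longrightarrow> A \<subseteq> B \<Longrightarrow> hausdorff_null s A"
  unfolding hausdorff_null_def by (metis hausdorff_pre_mono le_zero_eq)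

text \<open>The finite family is padded with empty sets to a sequence; these have diameter 0 and
  contribute \<open>0 powr s = 0\<close>.\<close>

lemma hausdorff_pre_finite_cover:
  assumes "finite P" "B \<subseteq> (\<Union>p\<in>P. D p)" "0 < \<delta>" "0 \<le> \<rho>" "\<rho> \<le> \<delta>" "0 \<le> s"
    and D: "\<And>p. p \<in> P \<Longrightarrow> bounded (D p) \<and> diameter (D p) \<le> \<rho>"
  shows "hausdorff_pre s \<delta> B \<le> ennreal (real (card P) * \<rho> powr s)"
proof -
  obtain e where e: "bij_betw e {..<card P} P"
    using ex_bij_betw_nat_finite[OF assms(1)] by (auto simp: atLeast0LessThan)
  define C where "C = (\<lambda>j. if j < card P then D (e j) else {})"
  have eP: "e j \<in> P" if "j < card P" for j
    using e that by (auto simp: bij_betw_def)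
  have "B \<subseteq> (\<Union>j. C j)"
  proof
    fix x assume "x \<in> B"
    then obtain p where p: "p \<in> P" "x \<in> D p" using assms(2) by auto
    then obtain j where "j < card P" "e j = p"
      using bij_betw_imp_surj_on[OF e] by (metis imageE lessThan_iff)
    thus "x \<in> (\<Union>j. C j)" using p by (auto simp: C_def intro!: exI[of _ j])
  qed
  moreover have "bounded (C j) \<and> diameter (C j) \<le> \<delta>" for j
    using D[OF eP, of j] assms by (auto simp: C_def)
  ultimately have "hausdorff_pre s \<delta> B \<le> (\<Sum>j. ennreal (diameter (C j) powr s))"
    by (rule hausdorff_pre_le_suminf)
  also have "\<dots> = (\<Sum>j<card P. ennreal (diameter (C j) powr s))"
    by (rule suminf_finite) (auto simp: C_def)
  also have "\<dots> \<le> (\<Sum>j<card P. ennreal (\<rho> powr s))"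
  proof (rule sum_mono)
    fix j assume "j \<in> {..<card P}"
    hence "0 \<le> diameter (C j)" "diameter (C j) \<le> \<rho>"
      using D[OF eP, of j] by (auto simp: C_def diameter_ge_0)
    thus "ennreal (diameter (C j) powr s) \<le> ennreal (\<rho> powr s)"
      using \<open>0 \<le> s\<close> by (intro ennreal_leI powr_mono2) auto
  qed
  also have "\<dots> = ennreal (real (card P) * \<rho> powr s)"
    by (simp add: ennreal_mult ennreal_of_nat_eq_real_of_nat)
  finally show ?thesis .
qed

text \<open>Geometric series argument: \<open>B n\<close> has a cover of total cost below
  \<open>\<epsilon> / 2 ^ (n + 1)\<close>, and \<open>prod_decode\<close> merges all these covers
  into a single sequence of cost at most \<open>\<epsilon>\<close>.\<close>

lemma hausdorff_null_UN:
  fixes B :: "nat \<Rightarrow> 'a::metric_space set"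
  assumes null: "\<And>n. hausdorff_null s (B n)"
  shows "hausdorff_null s (\<Union>n. B n)"
  unfolding hausdorff_null_def
proof (intro allI impI)
  fix \<delta> :: real assume \<delta>: "\<delta> > 0"
  have le: "hausdorff_pre s \<delta> (\<Union>n. B n) \<le> ennreal \<epsilon>" if \<epsilon>: "\<epsilon> > 0" for \<epsilon> :: real
  proof -
    have "\<exists>C. B n \<subseteq> (\<Union>j. C j) \<and> (\<forall>j. bounded (C j) \<and> diameter (C j) \<le> \<delta>) \<and>
           (\<Sum>j. ennreal (diameter (C j :: 'a set) powr s)) < ennreal (\<epsilon> * (1/2) ^ Suc n)" for n
    proof -
      have "hausdorff_pre s \<delta> (B n) < ennreal (\<epsilon> * (1/2) ^ Suc n)"
        using null[of n] \<delta> \<epsilon> by (simp add: hausdorff_null_def)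
      thus ?thesis unfolding hausdorff_pre_def INF_less_iff by auto
    qed
    then obtain C where C: "\<And>n. B n \<subseteq> (\<Union>j. C n j)"
        "\<And>n j. bounded (C n j) \<and> diameter (C n j :: 'a set) \<le> \<delta>"
        "\<And>n. (\<Sum>j. ennreal (diameter (C n j) powr s)) < ennreal (\<epsilon> * (1/2) ^ Suc n)"
      by metis
    let ?d = "\<lambda>(n, j). ennreal (diameter (C n j) powr s)"
    let ?C = "\<lambda>i. case prod_decode i of (n, j) \<Rightarrow> C n j"
    have "(\<Union>n. B n) \<subseteq> (\<Union>i. ?C i)"
    proof
      fix x assume "x \<in> (\<Union>n. B n)"
      then obtain n j where "x \<in> C n j" using C(1) by blast
      hence "x \<in> ?C (prod_encode (n, j))" by simp
      thus "x \<in> (\<Union>i. ?C i)" by (rule UN_I[OF UNIV_I])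
    qed
    moreover have "bounded (?C i) \<and> diameter (?C i) \<le> \<delta>" for i
      using C(2) by (auto split: prod.split)
    ultimately have "hausdorff_pre s \<delta> (\<Union>n. B n) \<le> (\<Sum>i. ennreal (diameter (?C i) powr s))"
      by (rule hausdorff_pre_le_suminf)
    also have "\<dots> = (\<Sum>i. ?d (prod_decode i))"
      by (intro arg_cong[where f=suminf] ext) (simp split: prod.split)
    also have "\<dots> = (\<Sum>n. \<Sum>j. ennreal (diameter (C n j) powr s))"
      by (rule suminf_ennreal_2dimen) simp
    also have "\<dots> \<le> (\<Sum>n. ennreal (\<epsilon> * (1/2) ^ Suc n))"
      by (intro suminf_le) (use C(3) in \<open>auto intro: less_imp_le\<close>)
    also have "\<dots> = ennreal (\<Sum>n. \<epsilon> * (1/2) ^ Suc n)"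
      using \<epsilon> power_half_series
      by (intro suminf_ennreal2) (auto intro!: summable_mult dest: sums_summable)
    also have "(\<Sum>n. \<epsilon> * (1/2) ^ Suc n) = \<epsilon>"
      using sums_unique[OF sums_mult[OF power_half_series, of \<epsilon>]] by simp
    finally show ?thesis .
  qed
  have "hausdorff_pre s \<delta> (\<Union>n. B n) \<le> 0"
    by (rule ennreal_le_epsilon) (simp add: le)
  thus "hausdorff_pre s \<delta> (\<Union>n. B n) = 0" by simp
qed

lemma hausdorff_null_countable_Union:
  assumes "countable I" "\<And>i. i \<in> I \<Longrightarrow> hausdorff_null s (B i)"
  shows "hausdorff_null s (\<Union>i\<in>I. B i :: 'a::metric_space set)"
proof (cases "I = {}")
  case True
  have "hausdorff_pre s \<delta> ({}::'a set) = 0" if "\<delta> > 0" for \<delta>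
    using hausdorff_pre_le_suminf[of "{}" "\<lambda>_. {}" \<delta> s] that by simp
  thus ?thesis using True by (simp add: hausdorff_null_def)
next
  case False
  have "(\<Union>i\<in>I. B i) = (\<Union>n. B (from_nat_into I n))"
    using range_from_nat_into[OF False assms(1)] by (metis image_image)
  thus ?thesis
    using hausdorff_null_UN[of s "\<lambda>n. B (from_nat_into I n)"] assms(2) from_nat_into[OF False] by auto
qed

text \<open>
  Cutting the \<open>card B\<close> free coordinates into \<open>N\<close> pieces each gives \<open>N ^ card B\<close> cells, whose
  images have diameter \<open>O(1 / N)\<close>.
\<close>

lemma hausdorff_null_lipschitz_image:
  fixes T :: "'a::euclidean_space set" and \<Phi> :: "'a \<Rightarrow> 'b::real_normed_vector"
  assumes "bounded T" and lip: "L-lipschitz_on T \<Phi>"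
    and B: "B \<subseteq> Basis" and const: "\<And>z b. z \<in> T \<Longrightarrow> b \<in> Basis - B \<Longrightarrow> z \<bullet> b = c b"
    and s: "real (card B) < s"
  shows "hausdorff_null s (\<Phi> ` T)"
  unfolding hausdorff_null_def
proof (intro allI impI)
  fix \<delta> :: real assume \<delta>: "\<delta> > 0"
  have finB: "finite B" using B finite_Basis finite_subset by blast
  obtain R where R: "R > 0" "\<And>z. z \<in> T \<Longrightarrow> norm z < R"
    using assms(1) bounded_pos_less by metis
  have L: "L \<ge> 0" using lip by (rule lipschitz_on_nonneg)
  \<comment> \<open>A cell has side \<open>2 * R / N\<close> in each free direction, so by the l1
    bound on the norm its image has diameter at most \<open>L * DIM('a) * 2 * R / N\<close>. The
    added 1 keeps \<open>K\<close> positive when \<open>L = 0\<close>.\<close>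
  define K where "K = L * (DIM('a) * (2 * R)) + 1"
  have K: "K > 0" using L R by (simp add: K_def add_nonneg_pos)
  have bound: "hausdorff_pre s \<delta> (\<Phi> ` T) \<le> ennreal (K powr s * real N powr (real (card B) - s))"
    if N: "N > 0" "K / N \<le> \<delta>" for N :: nat
  proof -
    \<comment> \<open>Index of the cell containing \<open>z\<close> in direction \<open>b\<close>,
      when the interval from \<open>-R\<close> to \<open>R\<close> is cut into \<open>N\<close>
      equal pieces.\<close>
    define q where "q = (\<lambda>(z::'a) b. nat \<lfloor>(z \<bullet> b + R) * N / (2 * R)\<rfloor>)"
    define P where "P = (B \<rightarrow>\<^sub>E {..<N})"
    define D where "D = (\<lambda>p. \<Phi> ` {z\<in>T. \<forall>b\<in>B. q z b = p b})"
    have zb: "- R < z \<bullet> b" "z \<bullet> b < R" if "z \<in> T" "b \<in> Basis" for z b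
      using Basis_le_norm[OF that(2), of z] R(2)[OF that(1)] by auto
    have qN: "q z b < N" if "z \<in> T" "b \<in> B" for z b
    proof -
      have "(z \<bullet> b + R) * N < (2 * R) * N"
        using zb[of z b] that B N by (intro mult_strict_right_mono) auto
      hence "(z \<bullet> b + R) * N / (2 * R) < N"
        using R(1) by (simp add: divide_less_eq mult.commute)
      hence "\<lfloor>(z \<bullet> b + R) * N / (2 * R)\<rfloor> < int N"
        by (simp add: floor_less_iff)
      thus ?thesis unfolding q_def using N(1) by linarith
    qed
    have "\<Phi> ` T \<subseteq> (\<Union>p\<in>P. D p)"
    proof
      fix y assume "y \<in> \<Phi> ` T"
      then obtain z where z: "z \<in> T" "y = \<Phi> z" by auto
      have "restrict (q z) B \<in> P" using qN[OF z(1)] by (auto simp: P_def)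
      moreover have "y \<in> D (restrict (q z) B)" using z by (auto simp: D_def)
      ultimately show "y \<in> (\<Union>p\<in>P. D p)" by blast
    qed
    moreover have "finite P" using finB by (auto simp: P_def intro: finite_PiE)
    moreover have "bounded (D p) \<and> diameter (D p) \<le> K / N" if "p \<in> P" for p
    proof -
      have d: "dist x y \<le> K / N" if xy: "x \<in> D p" "y \<in> D p" for x y
      proof -
        obtain u v where uv: "u \<in> T" "v \<in> T" "x = \<Phi> u" "y = \<Phi> v"
          "\<And>b. b \<in> B \<Longrightarrow> q u b = q v b"
          using xy by (auto simp: D_def)
        have co: "\<bar>(u - v) \<bullet> b\<bar> \<le> 2 * R / N" if b: "b \<in> Basis" for b
        proof (cases "b \<in> B")
          case True
          let ?a = "(u \<bullet> b + R) * N / (2 * R)" and ?b = "(v \<bullet> b + R) * N / (2 * R)"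
          have "?a \<ge> 0" "?b \<ge> 0" using zb[OF uv(1) b] zb[OF uv(2) b] R(1) by auto
          hence "\<lfloor>?a\<rfloor> = \<lfloor>?b\<rfloor>"
            using uv(5)[OF True] unfolding q_def by (subst (asm) eq_nat_nat_iff) auto
          hence "\<bar>?a - ?b\<bar> \<le> 1" by linarith
          also have "?a - ?b = ((u - v) \<bullet> b) * (N / (2 * R))"
            using R(1) by (simp add: inner_diff_left divide_simps) (simp add: algebra_simps)
          finally have "\<bar>(u - v) \<bullet> b\<bar> * (N / (2 * R)) \<le> 1"
            using R(1) by (simp add: abs_mult)
          thus ?thesis using R(1) N by (simp add: field_simps)
        next
          \<comment> \<open>Directions outside \<open>B\<close> are never subdivided, because
            \<open>T\<close> is constant along them; this is why the number of cells has exponent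
            \<open>card B\<close> and not \<open>DIM('a)\<close>.\<close>
          case False
          thus ?thesis using const[OF uv(1)] const[OF uv(2)] b R N by (simp add: inner_diff_left)
        qed
        have "dist x y \<le> L * dist u v" using lipschitz_onD[OF lip uv(1,2)] uv by simp
        also have "dist u v \<le> (\<Sum>b\<in>Basis. \<bar>(u - v) \<bullet> b\<bar>)"
          unfolding dist_norm by (rule norm_le_l1)
        also have "\<dots> \<le> (\<Sum>b\<in>(Basis::'a set). 2 * R / N)" by (intro sum_mono co)
        also have "\<dots> = DIM('a) * (2 * R) / N" by simp
        finally have "dist x y \<le> L * (DIM('a) * (2 * R) / N)" using L by (simp add: mult_left_mono)
        also have "\<dots> \<le> K / N" using N by (simp add: K_def field_simps)
        finally show ?thesis .
      qed
      have "bounded (D p)"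
        using d unfolding bounded_def by (cases "D p = {}") blast+
      moreover have "diameter (D p) \<le> K / N"
        using d K N by (intro diameter_le) (auto simp: dist_norm)
      ultimately show ?thesis ..
    qed
    ultimately have "hausdorff_pre s \<delta> (\<Phi> ` T) \<le> ennreal (real (card P) * (K / N) powr s)"
      using K N \<delta> s by (intro hausdorff_pre_finite_cover) auto
    also have "real (card P) = real N powr real (card B)"
      using N finB by (simp add: P_def card_funcsetE powr_realpow)
    also have "real N powr real (card B) * (K / N) powr s = K powr s * real N powr (real (card B) - s)"
      using K N by (simp add: powr_divide powr_diff)
    finally show ?thesis .
  qed
  \<comment> \<open>The exponent \<open>card B - s\<close> is negative, so the bound tends to 0. It
    is available once \<open>N \<ge> K / \<delta>\<close>, when the cells are small enough for the
    scale \<open>\<delta>\<close>.\<close>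
  have "((\<lambda>N. ennreal (K powr s * real N powr (real (card B) - s))) \<longlongrightarrow> ennreal (K powr s * 0)) sequentially"
    using s by (intro tendsto_ennrealI tendsto_mult tendsto_const tendsto_neg_powr)
      (auto intro: filterlim_real_sequentially)
  moreover have "\<forall>\<^sub>F N in sequentially. hausdorff_pre s \<delta> (\<Phi> ` T)
      \<le> ennreal (K powr s * real N powr (real (card B) - s))"
  proof -
    obtain N0 :: nat where N0: "K / \<delta> < N0" using reals_Archimedean2 by blast
    show ?thesis
    proof (rule eventually_sequentiallyI[of "max 1 N0"])
      fix N assume N: "max 1 N0 \<le> N"
      hence "K / \<delta> \<le> N" using N0 by linarith
      thus "hausdorff_pre s \<delta> (\<Phi> ` T) \<le> ennreal (K powr s * real N powr (real (card B) - s))"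
        using N \<delta> by (intro bound) (auto simp: field_simps)
    qed
  qed
  ultimately have "hausdorff_pre s \<delta> (\<Phi> ` T) \<le> ennreal (K powr s * 0)"
    by (intro tendsto_lowerbound[where F=sequentially]) auto
  thus "hausdorff_pre s \<delta> (\<Phi> ` T) = 0" by simp
qed

subsection \<open>Locally Lipschitz maps\<close>

text \<open>Neither the radius nor the constant is recorded: being a null set does not depend on
  them, and closure under arithmetic can then be checked point by point.\<close>

definition loclip_at :: "'a::metric_space \<Rightarrow> ('a \<Rightarrow> 'b::metric_space) \<Rightarrow> bool" where
  "loclip_at z f \<longleftrightarrow> (\<exists>e>0. \<exists>L. L-lipschitz_on (ball z e) f)"

lemma loclip_at_common_ball:
  assumes "loclip_at z f" "loclip_at z g"
  obtains e L M where "e > 0" "L-lipschitz_on (ball z e) f" "M-lipschitz_on (ball z e) g"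
proof -
  obtain d L where "d > 0" "L-lipschitz_on (ball z d) f" using assms(1) unfolding loclip_at_def by blast
  moreover obtain e M where "e > 0" "M-lipschitz_on (ball z e) g"
    using assms(2) unfolding loclip_at_def by blast
  ultimately show ?thesis
    by (intro that[of "min d e" L M]) (auto intro: lipschitz_on_subset)
qed

section \<open>Closure of local Lipschitz continuity under composition and arithmetic\<close>

lemma loclip_at_const [simp]: "loclip_at z (\<lambda>_. c)"
  unfolding loclip_at_def using lipschitz_on_constant zero_less_one by blast

lemma loclip_at_bounded_linear: "bounded_linear f \<Longrightarrow> loclip_at z f"
  unfolding loclip_at_def using bounded_linear.lipschitz_boundE lipschitz_on_subset subset_UNIV zero_less_one
  by metis

lemma loclip_at_add:
  fixes f g :: "'a::metric_space \<Rightarrow> 'b::real_normed_vector"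
  assumes "loclip_at z f" "loclip_at z g"
  shows "loclip_at z (\<lambda>x. f x + g x)"
  using loclip_at_common_ball[OF assms] lipschitz_on_add unfolding loclip_at_def by metis

lemma loclip_at_sum:
  fixes f :: "'i \<Rightarrow> 'a::metric_space \<Rightarrow> 'b::real_normed_vector"
  assumes "\<And>i. i \<in> I \<Longrightarrow> loclip_at z (f i)"
  shows "loclip_at z (\<lambda>x. \<Sum>i\<in>I. f i x)"
  using assms by (induction I rule: infinite_finite_induct) (auto intro: loclip_at_add)

lemma loclip_at_compose:
  assumes "loclip_at z f" "loclip_at (f z) g"
  shows "loclip_at z (\<lambda>x. g (f x))"
proof -
  obtain e L where e: "e > 0" "L-lipschitz_on (ball z e) f" using assms(1) unfolding loclip_at_def by blast
  obtain d M where d: "d > 0" "M-lipschitz_on (ball (f z) d) g"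
    using assms(2) unfolding loclip_at_def by blast
  have L: "L \<ge> 0" using e(2) by (rule lipschitz_on_nonneg)
  \<comment> \<open>On this smaller ball \<open>f\<close> stays within distance \<open>d\<close> of
    \<open>f z\<close>, where \<open>g\<close> is Lipschitz; \<open>L + 1\<close> avoids a division
    by 0.\<close>
  define e' where "e' = min e (d / (L + 1))"
  have e': "e' > 0" "e' \<le> e" using e d L by (auto simp: e'_def)
  have "f x \<in> ball (f z) d" if x: "x \<in> ball z e'" for x
  proof -
    have "dist (f z) (f x) \<le> L * dist z x"
      using x e' e by (intro lipschitz_onD[OF e(2)]) auto
    also have "\<dots> \<le> (L + 1) * dist z x" by (simp add: mult_right_mono)
    also have "\<dots> < (L + 1) * (d / (L + 1))"
      using x L by (intro mult_strict_left_mono) (auto simp: e'_def)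
    finally show ?thesis using L by simp
  qed
  hence "M-lipschitz_on (f ` ball z e') g" by (intro lipschitz_on_subset[OF d(2)]) auto
  moreover have "L-lipschitz_on (ball z e') f"
    using e' by (intro lipschitz_on_subset[OF e(2)]) auto
  ultimately show ?thesis
    unfolding loclip_at_def using lipschitz_on_compose2 e'(1) by blast
qed

text \<open>A Lipschitz function is bounded on a ball of finite radius, here by \<open>A\<close> and
  \<open>B\<close>, and on bounded factors the product rule for differences gives a Lipschitz
  constant.\<close>

lemma loclip_at_mult:
  fixes f g :: "'a::metric_space \<Rightarrow> real"
  assumes "loclip_at z f" "loclip_at z g"
  shows "loclip_at z (\<lambda>x. f x * g x)"
proof -
  obtain e L M where e: "e > 0" "L-lipschitz_on (ball z e) f" "M-lipschitz_on (ball z e) g"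
    using loclip_at_common_ball[OF assms] .
  have LM: "L \<ge> 0" "M \<ge> 0" using e lipschitz_on_nonneg by auto
  have bd: "\<bar>h x\<bar> \<le> \<bar>h z\<bar> + K * e" if "K-lipschitz_on (ball z e) h" "x \<in> ball z e"
    for h :: "'a \<Rightarrow> real" and K x
  proof -
    have "dist (h x) (h z) \<le> K * dist x z" using lipschitz_onD[OF that] e by simp
    also have "\<dots> \<le> K * e"
      using that lipschitz_on_nonneg by (intro mult_left_mono) (auto simp: dist_commute)
    finally show ?thesis by (simp add: dist_real_def)
  qed
  define A where "A = \<bar>f z\<bar> + L * e"
  define B where "B = \<bar>g z\<bar> + M * e"
  have "(A * M + B * L)-lipschitz_on (ball z e) (\<lambda>x. f x * g x)"
  proof (rule lipschitz_onI)
    fix x y assume xy: "x \<in> ball z e" "y \<in> ball z e"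
    have "f x * g x - f y * g y = f x * (g x - g y) + g y * (f x - f y)" by (simp add: algebra_simps)
    hence "dist (f x * g x) (f y * g y) \<le> \<bar>f x\<bar> * \<bar>g x - g y\<bar> + \<bar>g y\<bar> * \<bar>f x - f y\<bar>"
      by (metis abs_mult abs_triangle_ineq dist_real_def)
    also have "\<dots> \<le> A * (M * dist x y) + B * (L * dist x y)"
      using bd[OF e(2) xy(1)] bd[OF e(3) xy(2)] lipschitz_onD[OF e(2) xy] lipschitz_onD[OF e(3) xy]
      by (intro add_mono mult_mono) (auto simp: A_def B_def dist_real_def)
    finally show "dist (f x * g x) (f y * g y) \<le> (A * M + B * L) * dist x y"
      by (simp add: algebra_simps)
  qed (use LM e in \<open>auto simp: A_def B_def\<close>)
  thus ?thesis using e(1) unfolding loclip_at_def by blast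
qed

lemma loclip_at_inverse:
  fixes f :: "'a::metric_space \<Rightarrow> real"
  assumes "loclip_at z f" "f z \<noteq> 0"
  shows "loclip_at z (\<lambda>x. inverse (f x))"
proof -
  \<comment> \<open>Within distance \<open>r\<close> of \<open>f z\<close> all numbers have absolute
    value at least \<open>r\<close>, which gives \<open>inverse\<close> the Lipschitz constant
    \<open>1 / r^2\<close> there.\<close>
  define r where "r = \<bar>f z\<bar> / 2"
  have r: "r > 0" using assms(2) by (simp add: r_def)
  have "(inverse (r * r))-lipschitz_on (ball (f z) r) inverse"
  proof (rule lipschitz_onI)
    fix x y assume "x \<in> ball (f z) r" "y \<in> ball (f z) r"
    hence xy: "r \<le> \<bar>x\<bar>" "r \<le> \<bar>y\<bar>" unfolding mem_ball dist_real_def r_def by linarith+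
    hence "x \<noteq> 0" "y \<noteq> 0" using r by auto
    hence "dist (inverse x) (inverse y) = inverse (\<bar>x\<bar> * \<bar>y\<bar>) * dist x y"
      by (simp add: dist_real_def inverse_diff_inverse abs_mult abs_minus_commute)
    also have "\<dots> \<le> inverse (r * r) * dist x y"
      using xy r by (intro mult_right_mono le_imp_inverse_le mult_mono) auto
    finally show "dist (inverse x) (inverse y) \<le> inverse (r * r) * dist x y" .
  qed (use r in simp)
  hence "loclip_at (f z) inverse" using r unfolding loclip_at_def by blast
  thus ?thesis by (rule loclip_at_compose[OF assms(1)])
qed

lemma loclip_at_vec_lambda:
  fixes f :: "'i::finite \<Rightarrow> 'a::metric_space \<Rightarrow> 'b::real_normed_vector"
  assumes "\<And>i. loclip_at z (f i)"
  shows "loclip_at z (\<lambda>x. \<chi> i. f i x)"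
proof -
  \<comment> \<open>Stated for index sets \<open>I\<close> so that induction yields one ball and one
    constant serving all components.\<close>
  have "\<exists>e>0. \<exists>L. \<forall>i\<in>I. L-lipschitz_on (ball z e) (f i)" for I
  proof (induction I rule: infinite_finite_induct)
    case (insert i I)
    obtain d L where "d > 0" "L-lipschitz_on (ball z d) (f i)"
      using assms[of i] unfolding loclip_at_def by blast
    moreover obtain e M where "e > 0" "\<forall>i\<in>I. M-lipschitz_on (ball z e) (f i)"
      using insert.IH by blast
    ultimately have "min d e > 0" "\<forall>j\<in>insert i I. (max L M)-lipschitz_on (ball z (min d e)) (f j)"
      by (auto intro: lipschitz_on_mono)
    thus ?case by blast
  qed (auto intro: exI[of _ 1])
  then obtain e L where e: "e > 0" "\<And>i. L-lipschitz_on (ball z e) (f i)" by (metis UNIV_I)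
  have "(CARD('i) * L)-lipschitz_on (ball z e) (\<lambda>x. \<chi> i. f i x)"
  proof (rule lipschitz_onI)
    fix x y assume xy: "x \<in> ball z e" "y \<in> ball z e"
    have "dist (\<chi> i. f i x) (\<chi> i. f i y) \<le> (\<Sum>i\<in>UNIV. dist (f i x) (f i y))"
      by (simp add: dist_vec_def L2_set_le_sum)
    also have "\<dots> \<le> (\<Sum>i\<in>(UNIV::'i set). L * dist x y)"
      by (intro sum_mono lipschitz_onD[OF e(2) xy])
    finally show "dist (\<chi> i. f i x) (\<chi> i. f i y) \<le> CARD('i) * L * dist x y" by simp
  qed (use lipschitz_on_nonneg[OF e(2)] in simp)
  thus ?thesis using e(1) unfolding loclip_at_def by blast
qed

lemma loclip_at_vec_nth:
  fixes f :: "'a::metric_space \<Rightarrow> 'b::real_normed_vector ^ 'i::finite"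
  assumes "loclip_at z f"
  shows "loclip_at z (\<lambda>x. f x $ i)"
  by (rule loclip_at_compose[OF assms loclip_at_bounded_linear[OF bounded_linear_vec_nth]])

section \<open>C^1 maps are locally Lipschitz, and locally Lipschitz images are null\<close>

lemma loclip_at_C1:
  fixes u :: "'a::euclidean_space \<Rightarrow> 'b::euclidean_space"
  assumes C1: "Ck_on (Suc 0) S u" and "open S" "z \<in> S"
  shows "loclip_at z u"
proof -
  \<comment> \<open>\<open>N x\<close> dominates the operator norm of the derivative at
    \<open>x\<close> and is continuous. Hence \<open>N z + 1\<close> bounds that norm on a ball
    around \<open>z\<close>, and the mean value inequality makes it a Lipschitz constant.\<close>
  define N where "N = (\<lambda>x. \<Sum>b\<in>Basis. norm (frechet_derivative u (at x) b))"
  have diff: "(u has_derivative frechet_derivative u (at x)) (at x)" if "x \<in> S" for x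
    using C1 that by (simp add: frechet_derivative_works)
  have "continuous_on S N" using C1 unfolding N_def by (intro continuous_intros) auto
  hence "isCont N z" using assms(2,3) continuous_on_eq_continuous_at by blast
  then obtain d where d: "d > 0" "\<And>x. dist x z < d \<Longrightarrow> dist (N x) (N z) < 1"
    unfolding continuous_at_eps_delta by (metis zero_less_one)
  obtain d' where d': "d' > 0" "ball z d' \<subseteq> S" using assms(2,3) open_contains_ball by blast
  define e where "e = min d d'"
  have e: "e > 0" "ball z e \<subseteq> S" using d d' by (auto simp: e_def)
  have "(N z + 1)-lipschitz_on (ball z e) u"
  proof (rule lipschitz_onI)
    fix x y assume xy: "x \<in> ball z e" "y \<in> ball z e"
    have on: "onorm (frechet_derivative u (at w)) \<le> N z + 1" if w: "w \<in> ball z e" for w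
    proof -
      have lin: "linear (frechet_derivative u (at w))"
        using diff[of w] e w has_derivative_linear by blast
      have "onorm (frechet_derivative u (at w)) \<le> N w"
      proof (rule onorm_le)
        fix v :: 'a
        have "frechet_derivative u (at w) v = (\<Sum>b\<in>Basis. (v \<bullet> b) *\<^sub>R frechet_derivative u (at w) b)"
          by (subst euclidean_representation[of v, symmetric])
             (simp only: linear_sum[OF lin] linear_cmul[OF lin])
        hence "norm (frechet_derivative u (at w) v)
            \<le> (\<Sum>b\<in>Basis. norm ((v \<bullet> b) *\<^sub>R frechet_derivative u (at w) b))"
          by (simp only: norm_sum)
        also have "\<dots> \<le> (\<Sum>b\<in>Basis. norm v * norm (frechet_derivative u (at w) b))"
          by (intro sum_mono) (auto intro!: mult_right_mono Basis_le_norm)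
        finally show "norm (frechet_derivative u (at w) v) \<le> N w * norm v"
          by (simp add: N_def sum_distrib_left mult.commute)
      qed
      also have "N w \<le> N z + 1"
        using d(2)[of w] w by (simp add: e_def dist_real_def dist_commute)
      finally show ?thesis .
    qed
    have "norm (u x - u y) \<le> (N z + 1) * norm (x - y)"
    proof (rule differentiable_bound[OF convex_ball _ on xy])
      fix w assume "w \<in> ball z e"
      thus "(u has_derivative frechet_derivative u (at w)) (at w within ball z e)"
        using diff[of w] e has_derivative_at_withinI by blast
    qed
    thus "dist (u x) (u y) \<le> (N z + 1) * dist x y" by (simp add: dist_norm)
  qed (auto simp: N_def intro!: add_nonneg_nonneg sum_nonneg)
  thus ?thesis using e(1) unfolding loclip_at_def by blast
qed

text \<open>By Lindelof, countably many bounded open sets on which \<open>\<Phi>\<close> is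
  Lipschitz cover \<open>T\<close>, so the bounded Lipschitz case and countable unions
  suffice.\<close>

lemma hausdorff_null_loclip_image:
  fixes T :: "'a::euclidean_space set" and \<Phi> :: "'a \<Rightarrow> 'b::real_normed_vector"
  assumes lip: "\<And>z. z \<in> T \<Longrightarrow> loclip_at z \<Phi>"
    and B: "B \<subseteq> Basis" and const: "\<And>z b. z \<in> T \<Longrightarrow> b \<in> Basis - B \<Longrightarrow> z \<bullet> b = c b"
    and s: "real (card B) < s"
  shows "hausdorff_null s (\<Phi> ` T)"
proof -
  define \<U> where "\<U> = {U. open U \<and> bounded U \<and> (\<exists>L. L-lipschitz_on U \<Phi>)}"
  obtain \<V> where V: "\<V> \<subseteq> \<U>" "countable \<V>" "\<Union>\<V> = \<Union>\<U>"
    by (rule Lindelof[of \<U>]) (auto simp: \<U>_def)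
  have "T \<subseteq> \<Union>\<U>"
  proof
    fix z assume "z \<in> T"
    then obtain e L where "e > 0" "L-lipschitz_on (ball z e) \<Phi>" using lip unfolding loclip_at_def by blast
    hence "ball z e \<in> \<U>" "z \<in> ball z e" by (auto simp: \<U>_def)
    thus "z \<in> \<Union>\<U>" by blast
  qed
  hence "\<Phi> ` T = (\<Union>U\<in>\<V>. \<Phi> ` (T \<inter> U))" using V(3) by blast
  moreover have "hausdorff_null s (\<Phi> ` (T \<inter> U))" if U: "U \<in> \<V>" for U
  proof -
    obtain L where L: "bounded U" "L-lipschitz_on U \<Phi>" using U V(1) by (auto simp: \<U>_def)
    show ?thesis
      using const s
      by (intro hausdorff_null_lipschitz_image[OF bounded_subset[OF L(1)] lipschitz_on_subset[OF L(2)] B])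
         auto
  qed
  ultimately show ?thesis using hausdorff_null_countable_Union[OF V(2)] by metis
qed

subsection \<open>Non-immersive perturbations in a chart\<close>

text \<open>Second order differentiability enters here: the entries are first partial derivatives of
  a C^2 map, hence C^1.\<close>

lemma loclip_at_frechet_matrix:
  fixes F :: "real ^ 'n \<Rightarrow> real ^ 'm"
  assumes "Ck_on 2 S F" "open S" "x \<in> S"
  shows "loclip_at x (\<lambda>x. matrix (frechet_derivative F (at x)) $ a $ b)"
proof -
  have "Ck_on (Suc 0) S (\<lambda>x. frechet_derivative F (at x) (axis b 1))"
    using assms(1) by (simp add: numeral_2_eq_2)
  hence "loclip_at x (\<lambda>x. frechet_derivative F (at x) (axis b 1) $ a)"
    using assms by (intro loclip_at_vec_nth loclip_at_C1)
  thus ?thesis by (simp add: matrix_def)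
qed

lemma hausdorff_null_singular_perturbations:
  fixes F :: "real ^ 'n \<Rightarrow> real ^ 'm" and g :: "real ^ 'm \<Rightarrow> real ^ 'l"
  assumes S: "open S" "Ck_on 2 S F" and V: "open V" "F ` S \<subseteq> V" "Ck_on 2 V g"
    and inj: "\<And>x. x \<in> S \<Longrightarrow> inj (frechet_derivative F (at x))"
    and s: "s > real CARD('m) * real CARD('l) + (2 * real CARD('n) - real CARD('l) - 1)"
  shows "hausdorff_null s {M :: real ^ 'm ^ 'l. \<exists>x\<in>S. \<exists>v. v \<noteq> 0 \<and>
           frechet_derivative g (at (F x)) (frechet_derivative F (at x) v)
             + M *v frechet_derivative F (at x) v = 0}"
    (is "hausdorff_null s ?\<Sigma>")
proof -
  define A where "A = (\<lambda>x. matrix (frechet_derivative F (at x)))"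
  define G where "G = (\<lambda>x. matrix (frechet_derivative g (at (F x))))"
  \<comment> \<open>A parameter \<open>z\<close> is a triple of a point \<open>x\<close>, a
    direction \<open>v\<close> and a matrix; \<open>w z\<close> is the image of \<open>v\<close>
    under the derivative of \<open>F\<close> at \<open>x\<close>.\<close>
  define w where "w = (\<lambda>z :: (real^'n) \<times> (real^'n) \<times> (real^'m^'l). A (fst z) *v fst (snd z))"
  define \<Phi> where "\<Phi> = (\<lambda>j z. (\<chi> a b.
      (if b = j then - (\<Sum>k\<in>UNIV - {j}. w z $ k * inverse (w z $ j) * snd (snd z) $ a $ k)
       else snd (snd z) $ a $ b) - G (fst z) $ a $ b) :: real^'m^'l)"
  \<comment> \<open>Column \<open>j\<close> of \<open>\<Phi> j z + G\<close> is the one making \<open>w z\<close> a null vector; the parameter's own column \<open>j\<close>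
    carries no information and is set to 0 in \<open>T\<close>.\<close>
  define T where "T = (\<lambda>i j. {z. fst z \<in> S \<and> fst (snd z) $ i = 1 \<and> w z $ j \<noteq> 0
      \<and> (\<forall>a. snd (snd z) $ a $ j = 0)})"
  have diffF: "(F has_derivative frechet_derivative F (at x)) (at x)" if "x \<in> S" for x
    using S that by (simp add: frechet_derivative_works numeral_2_eq_2)
  have diffg: "(g has_derivative frechet_derivative g (at (F x))) (at (F x))" if "x \<in> S" for x
    using V that by (auto simp: frechet_derivative_works numeral_2_eq_2)
  have Av: "A x *v v = frechet_derivative F (at x) v" if "x \<in> S" for x v
    unfolding A_def using diffF[OF that] has_derivative_linear matrix_vector_mul(2) by metis
  have Gw: "G x *v v = frechet_derivative g (at (F x)) v" if "x \<in> S" for x v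
    unfolding G_def using diffg[OF that] has_derivative_linear matrix_vector_mul(2) by metis
  have null: "hausdorff_null s (\<Phi> j ` T i j)" for i j
  proof -
    let ?b = "(0, axis i 1, 0) :: (real^'n) \<times> (real^'n) \<times> (real^'m^'l)"
    let ?c = "\<lambda>a. (0, 0, axis a (axis j 1)) :: (real^'n) \<times> (real^'n) \<times> (real^'m^'l)"
    let ?R = "insert ?b (range ?c)"
    have R: "?R \<subseteq> Basis" by (auto simp: Basis_prod_def image_iff)
    have "inj ?c" by (rule injI) (simp add: axis_eq_axis)
    hence "card (range ?c) = CARD('l)" by (rule card_image)
    moreover have "?b \<notin> range ?c" by (auto simp: axis_eq_0_iff)
    ultimately have "card ?R = CARD('l) + 1" by simp
    moreover have "card (Basis - ?R) = card (Basis :: ((real^'n) \<times> (real^'n) \<times> (real^'m^'l)) set) - card ?R"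
      by (rule card_Diff_subset[OF _ R]) simp
    moreover have "card ?R \<le> card (Basis :: ((real^'n) \<times> (real^'n) \<times> (real^'m^'l)) set)"
      by (rule card_mono[OF _ R]) simp
    ultimately have card: "real (card (Basis - ?R)) < s"
      using s by (simp add: of_nat_diff algebra_simps)
    show ?thesis
    proof (rule hausdorff_null_loclip_image[OF _ Diff_subset _ card, where c = "\<lambda>b. if b = ?b then 1 else 0"])
      fix z b assume "z \<in> T i j" "b \<in> Basis - (Basis - ?R)"
      thus "z \<bullet> b = (if b = ?b then 1 else 0)"
        by (cases z) (auto simp: T_def inner_axis axis_eq_0_iff)
    next
      fix z assume z: "z \<in> T i j"
      hence fz: "fst z \<in> S" and wj: "w z $ j \<noteq> 0" by (auto simp: T_def)
      have x: "loclip_at z fst" and v: "loclip_at z (\<lambda>z. fst (snd z))" and M: "loclip_at z (\<lambda>z. snd (snd z))"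
        by (auto intro!: loclip_at_bounded_linear bounded_linear_intros)
      have lA: "loclip_at z (\<lambda>z. A (fst z) $ a $ b)" for a b
        unfolding A_def
        by (rule loclip_at_compose[OF x loclip_at_frechet_matrix[OF S(2,1) fz]])
      have "loclip_at (fst z) F"
      proof (rule loclip_at_C1[OF _ S(1) fz])
        \<comment> \<open>Passing from C^2 to C^1: the directional derivatives are differentiable,
          hence continuous.\<close>
        have "Ck_on 0 S (\<lambda>x. frechet_derivative F (at x) v)" for v
          using S by (auto simp: numeral_2_eq_2 intro!: differentiable_imp_continuous_on)
             (meson differentiable_at_imp_differentiable_on)
        thus "Ck_on (Suc 0) S F" using S(2) by (auto simp: numeral_2_eq_2)
      qed
      hence lG: "loclip_at z (\<lambda>z. G (fst z) $ a $ b)" for a b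
        unfolding G_def using loclip_at_frechet_matrix[OF V(3,1), of "F (fst z)"] V(2) fz
        by (intro loclip_at_compose[OF loclip_at_compose[OF x]]) auto
      have lw: "loclip_at z (\<lambda>z. w z $ k)" for k
        unfolding w_def matrix_vector_mult_def
        by (simp, intro loclip_at_sum loclip_at_mult lA loclip_at_vec_nth v)
      have neg: "loclip_at z (\<lambda>z. - h z)" if "loclip_at z h" for h :: "_ \<Rightarrow> real"
        using loclip_at_mult[OF loclip_at_const[of z "-1"] that] by simp
      have "loclip_at z (\<lambda>z. (if b = j then - (\<Sum>k\<in>UNIV - {j}. w z $ k * inverse (w z $ j) * snd (snd z) $ a $ k)
          else snd (snd z) $ a $ b) + - G (fst z) $ a $ b)" for a b
        by (cases "b = j"; simp only: simp_thms if_True if_False;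
            intro loclip_at_add neg loclip_at_sum loclip_at_mult loclip_at_inverse[where f="\<lambda>z. w z $ j", OF _ wj]
              lw lG loclip_at_vec_nth M)
      thus "loclip_at z (\<Phi> j)" unfolding \<Phi>_def by (intro loclip_at_vec_lambda) simp
    qed
  qed
  have "?\<Sigma> \<subseteq> (\<Union>p\<in>UNIV. \<Phi> (snd p) ` T (fst p) (snd p))"
  proof
    fix M assume "M \<in> ?\<Sigma>"
    then obtain x v where x: "x \<in> S" and v: "v \<noteq> 0"
      and eq: "G x *v (A x *v v) + M *v (A x *v v) = 0" using Av Gw by auto
    obtain i where i: "v $ i \<noteq> 0" using v by (auto simp: vec_eq_iff)
    \<comment> \<open>The kernel condition is homogeneous in the direction, so it survives rescaling
      the \<open>i\<close>-th coordinate to 1.\<close>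
    define u where "u = inverse (v $ i) *\<^sub>R v"
    have "u \<noteq> 0" using v i by (simp add: u_def)
    \<comment> \<open>Injectivity of the derivative of \<open>F\<close> provides a nonzero entry
      \<open>j\<close> of the image vector, the pivot by which one divides.\<close>
    moreover have "inj ((*v) (A x))" using inj[OF x] Av[OF x] by (simp add: fun_eq_iff[symmetric] inj_def)
    ultimately have "A x *v u \<noteq> 0" by (metis injD matrix_vector_mult_0_right)
    then obtain j where j: "(A x *v u) $ j \<noteq> 0" by (auto simp: vec_eq_iff)
    define N where "N = M + G x"
    have N: "(\<Sum>k\<in>UNIV. N $ a $ k * (A x *v u) $ k) = 0" for a
    proof -
      have "N *v (A x *v u) = inverse (v $ i) *\<^sub>R (N *v (A x *v v))"
        by (simp add: u_def matrix_vector_mult_scaleR)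
      also have "N *v (A x *v v) = 0"
        using eq by (simp add: N_def matrix_vector_mult_add_rdistrib add.commute)
      finally have "(N *v (A x *v u)) $ a = 0" by simp
      thus ?thesis by (simp add: matrix_vector_mult_def)
    qed
    \<comment> \<open>Column \<open>j\<close> of \<open>N\<close> is erased; it is recovered below
      by solving each row of \<open>N *v (A x *v u) = 0\<close> for its entry in that
      column.\<close>
    define z where "z = (x, u, (\<chi> a b. if b = j then 0 else N $ a $ b) :: real^'m^'l)"
    have "z \<in> T i j" using x j i by (simp add: z_def T_def w_def u_def)
    moreover have "\<Phi> j z = M"
    proof -
      have "- (\<Sum>k\<in>UNIV - {j}. (A x *v u) $ k * inverse ((A x *v u) $ j) * N $ a $ k) = N $ a $ j" for a
      proof -
        have "(\<Sum>k\<in>UNIV - {j}. N $ a $ k * (A x *v u) $ k) = - (N $ a $ j * (A x *v u) $ j)"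
          using N[of a] by (subst (asm) sum.remove[of _ j]) auto
        moreover have "(\<Sum>k\<in>UNIV - {j}. (A x *v u) $ k * inverse ((A x *v u) $ j) * N $ a $ k)
            = inverse ((A x *v u) $ j) * (\<Sum>k\<in>UNIV - {j}. N $ a $ k * (A x *v u) $ k)"
          by (simp add: sum_distrib_left mult_ac)
        ultimately show ?thesis using j by simp
      qed
      moreover have "(\<Sum>k\<in>UNIV - {j}. w z $ k * inverse (w z $ j) * snd (snd z) $ a $ k)
          = (\<Sum>k\<in>UNIV - {j}. (A x *v u) $ k * inverse ((A x *v u) $ j) * N $ a $ k)" for a
        by (intro sum.cong) (auto simp: z_def w_def)
      ultimately show ?thesis by (simp add: \<Phi>_def vec_eq_iff) (simp add: z_def N_def)
    qed
    ultimately show "M \<in> (\<Union>p\<in>UNIV. \<Phi> (snd p) ` T (fst p) (snd p))"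
      by (intro UN_I[of "(i, j)"]) auto
  qed
  moreover have "hausdorff_null s (\<Union>p\<in>UNIV. \<Phi> (snd p) ` T (fst p) (snd p))"
    by (intro hausdorff_null_countable_Union null) simp
  ultimately show ?thesis by (rule hausdorff_null_subset[rotated])
qed

subsection \<open>Change of charts\<close>

lemma is_chart_inj_on: "is_chart X (U, \<phi>) \<Longrightarrow> inj_on \<phi> U"
  unfolding is_chart_def homeomorphic_map_def
  using openin_subset topspace_subtopology_subset by fastforce

lemma is_chart_open_image:
  assumes "is_chart X (U, \<phi>)" "openin X W"
  shows "open (\<phi> ` (U \<inter> W))"
proof -
  have hm: "homeomorphic_map (subtopology X U) (top_of_set (\<phi> ` U)) \<phi>" and o: "open (\<phi> ` U)"
    using assms(1) by (auto simp: is_chart_def)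
  have "openin (subtopology X U) (U \<inter> W)"
    using assms(2) by (auto simp: openin_subtopology)
  hence "openin (top_of_set (\<phi> ` U)) (\<phi> ` (U \<inter> W))"
    using homeomorphic_imp_open_map[OF hm] by (auto simp: open_map_def)
  thus ?thesis using o openin_open_trans by blast
qed

lemma Cr_related_differentiable:
  assumes "Cr_related r (U, \<phi>) (W, \<psi>)" "r \<ge> 1" "q \<in> U \<inter> W"
  shows "(\<psi> \<circ> inv_into U \<phi>) differentiable (at (\<phi> q))"
proof -
  have "Ck_on (Suc 0) (\<phi> ` (U \<inter> W)) (\<psi> \<circ> inv_into U \<phi>)"
    using assms(1,2) unfolding Cr_related_def Cr_on_def by (auto simp: one_enat_def dest: spec[of _ 1])
  thus ?thesis using assms(3) by simp
qed

text \<open>Transfers injectivity of the derivative at \<open>q\<close> from one chart to another,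
  so that a countable subatlas can decide whether a map is an immersion in all charts. The new
  derivative is \<open>D\<close> composed with that of the transition map.\<close>

lemma immersion_at_change_chart:
  fixes \<A> :: "('x, 'e::euclidean_space) chart set" and h :: "'x \<Rightarrow> 'b::euclidean_space"
  assumes man: "Cr_manifold r X \<A>" and r: "r \<ge> 1"
    and U: "(U, \<phi>) \<in> \<A>" and W: "(W, \<psi>) \<in> \<A>" and q: "q \<in> U \<inter> W"
    and D: "((h \<circ> inv_into W \<psi>) has_derivative D) (at (\<psi> q))" "inj D"
  shows "\<exists>D'. ((h \<circ> inv_into U \<phi>) has_derivative D') (at (\<phi> q)) \<and> inj D'"
proof -
  have cU: "is_chart X (U, \<phi>)" and cW: "is_chart X (W, \<psi>)"
    using man U W by (auto simp: Cr_manifold_def)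
  note injs = is_chart_inj_on[OF cU] is_chart_inj_on[OF cW]
  have op: "open (\<phi> ` (U \<inter> W))"
    using is_chart_open_image[OF cU] cW by (simp add: is_chart_def)
  define \<tau> \<sigma> where "\<tau> = \<psi> \<circ> inv_into U \<phi>" and "\<sigma> = \<phi> \<circ> inv_into W \<psi>"
  have \<tau>: "\<tau> (\<phi> p) = \<psi> p" and \<sigma>: "\<sigma> (\<psi> p) = \<phi> p" if "p \<in> U \<inter> W" for p
    using that injs by (auto simp: \<tau>_def \<sigma>_def)
  have rel: "Cr_related r (U, \<phi>) (W, \<psi>)" "Cr_related r (W, \<psi>) (U, \<phi>)"
    using man U W unfolding Cr_manifold_def by blast+
  have "\<tau> differentiable (at (\<phi> q))" "\<sigma> differentiable (at (\<psi> q))"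
    using Cr_related_differentiable[OF rel(1) r q] Cr_related_differentiable[OF rel(2) r, of q] q
    by (simp_all add: \<tau>_def \<sigma>_def)
  then obtain D\<tau> D\<sigma> where d\<tau>: "(\<tau> has_derivative D\<tau>) (at (\<phi> q))"
    and d\<sigma>: "(\<sigma> has_derivative D\<sigma>) (at (\<psi> q))"
    unfolding differentiable_def by blast
  \<comment> \<open>The two transition maps are mutually inverse on the open overlap, so the chain
    rule gives \<open>D\<tau>\<close> the left inverse \<open>D\<sigma>\<close>.\<close>
  have "(\<sigma> \<circ> \<tau> has_derivative D\<sigma> \<circ> D\<tau>) (at (\<phi> q))"
    by (rule diff_chain_at[OF d\<tau>]) (simp add: \<tau>[OF q] d\<sigma>)
  hence "((\<lambda>x. x) has_derivative D\<sigma> \<circ> D\<tau>) (at (\<phi> q))"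
    by (rule has_derivative_transform_within_open[OF _ op]) (use q \<tau> \<sigma> in auto)
  hence "D\<sigma> \<circ> D\<tau> = (\<lambda>x. x)"
    using has_derivative_unique has_derivative_ident by blast
  hence "inj D\<tau>" by (metis inj_on_imageI2 inj_on_id2)
  hence "inj (D \<circ> D\<tau>)" using D(2) by (simp add: inj_compose)
  moreover have "((h \<circ> inv_into W \<psi>) \<circ> \<tau> has_derivative D \<circ> D\<tau>) (at (\<phi> q))"
    by (rule diff_chain_at[OF d\<tau>]) (simp add: \<tau>[OF q] D)
  hence "((h \<circ> inv_into U \<phi>) has_derivative D \<circ> D\<tau>) (at (\<phi> q))"
    by (rule has_derivative_transform_within_open[OF _ op]) (use q \<tau> injs in auto)
  ultimately show ?thesis by blast
qed

text \<open>A second countable space is Lindelof, so countably many chart domains cover it, and one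
  chart is chosen for each. Countability is what permits a union of null sets over charts.\<close>

lemma Cr_manifold_countable_subatlas:
  assumes "Cr_manifold r X \<A>"
  obtains \<B> where "\<B> \<subseteq> \<A>" "countable \<B>" "(\<Union>c\<in>\<B>. fst c) = topspace X"
proof -
  have "Lindelof_space X"
    using assms by (simp add: Cr_manifold_def second_countable_imp_Lindelof_space)
  moreover have "openin X U" if "U \<in> fst ` \<A>" for U
    using that assms by (force simp: Cr_manifold_def is_chart_def)
  moreover have "\<Union>(fst ` \<A>) = topspace X" using assms by (simp add: Cr_manifold_def)
  ultimately obtain \<V> where "countable \<V>" "\<V> \<subseteq> fst ` \<A>" "\<Union>\<V> = topspace X"
    by (metis Lindelof_spaceD)
  thus ?thesis using that countable_subset_image by metis
qed

section \<open>From charts to the manifold\<close>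

theorem theorem5p7:
  fixes X :: "'x topology"
    and \<A> :: "('x, real ^ 'n) chart set"
    and f :: "'x \<Rightarrow> real ^ 'm"
    and V :: "(real ^ 'm) set"
    and g :: "real ^ 'm \<Rightarrow> real ^ 'l"
    and r :: enat
    and s :: real
  assumes "r \<ge> 2"
    and "CARD('l) \<ge> 2 * CARD('n)"
    and "Cr_manifold r X \<A>"
    and "open V"
    and "f ` topspace X \<subseteq> V"
    and "Cr_map r \<A> f"
    and "immersion \<A> f"
    and "Cr_on r V g"
    and "s > real CARD('m) * real CARD('l)
             + (2 * real CARD('n) - real CARD('l) - 1)"
  shows "hausdorff_outer s
           (matrix ` {\<pi> :: real ^ 'm \<Rightarrow> real ^ 'l.
              linear \<pi> \<and> \<not> immersion \<A> (\<lambda>q. g (f q) + \<pi> (f q))}) = 0"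
proof (rule hausdorff_outer_eq_0)
  \<comment> \<open>At \<open>s = 0\<close> the outer measure would count points. Since
    \<open>m\<close> and \<open>n\<close> are at least 1, the lower bound for \<open>s\<close> is at
    least 1.\<close>
  have "real CARD('l) \<le> real CARD('m) * real CARD('l)" "real CARD('n) \<ge> 1"
    by (simp_all add: Suc_leI)
  thus "s \<noteq> 0" using assms(9) by linarith
next
  obtain \<B> where B: "\<B> \<subseteq> \<A>" "countable \<B>" "(\<Union>c\<in>\<B>. fst c) = topspace X"
    using Cr_manifold_countable_subatlas[OF assms(3)] .
  define F where "F = (\<lambda>(W, \<psi>). f \<circ> inv_into W \<psi> :: real^'n \<Rightarrow> real^'m)"
  \<comment> \<open>Matrices of those perturbations whose composite with \<open>f\<close>, read in
    the chart \<open>c\<close>, has a derivative with nontrivial kernel at some point.\<close>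
  define \<Sigma> where "\<Sigma> = (\<lambda>c. {M :: real ^ 'm ^ 'l. \<exists>x\<in>snd c ` fst c. \<exists>v. v \<noteq> 0 \<and>
      frechet_derivative g (at (F c x)) (frechet_derivative (F c) (at x) v)
      + M *v frechet_derivative (F c) (at x) v = 0})"
  have r: "r \<ge> 1" using assms(1) by (metis one_le_numeral order_trans)
  have gV: "Ck_on 2 V g" using assms(1,8) by (simp add: Cr_on_def numeral_eq_enat)
  have charts: "is_chart X c" if "c \<in> \<A>" for c using that assms(3) by (simp add: Cr_manifold_def)
  have op: "open (snd c ` fst c)" if "c \<in> \<A>" for c
    using charts[OF that] by (auto simp: is_chart_def split: prod.splits)
  have inv: "inv_into (fst c) (snd c) (snd c q) = q" if "c \<in> \<A>" "q \<in> fst c" for c q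
    using is_chart_inj_on[of X "fst c" "snd c"] charts[OF that(1)] that(2) by simp
  have FV: "F c ` (snd c ` fst c) \<subseteq> V" if "c \<in> \<A>" for c
  proof -
    have "fst c \<subseteq> topspace X" using that assms(3) by (auto simp: Cr_manifold_def)
    thus ?thesis
      using assms(5) inv[OF that] by (auto simp: F_def case_prod_beta image_subset_iff subset_iff)
  qed
  have F2: "Ck_on 2 (snd c ` fst c) (F c)" if "c \<in> \<A>" for c
    using that assms(1,6) by (auto simp: Cr_map_def F_def Cr_on_def numeral_eq_enat case_prod_beta)
  have dF: "(F c has_derivative frechet_derivative (F c) (at x)) (at x)"
    "inj (frechet_derivative (F c) (at x))" if c: "c \<in> \<A>" and x: "x \<in> snd c ` fst c" for c x
  proof -
    obtain q where q: "q \<in> fst c" "x = snd c q" using x by blast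
    have "\<exists>D. (F c has_derivative D) (at x) \<and> inj D"
      using assms(7) c q unfolding immersion_def F_def by (auto simp: case_prod_beta)
    then obtain D where D: "(F c has_derivative D) (at x)" "inj D" by blast
    moreover have "frechet_derivative (F c) (at x) = D" using frechet_derivative_at[OF D(1)] by simp
    ultimately show "(F c has_derivative frechet_derivative (F c) (at x)) (at x)"
      "inj (frechet_derivative (F c) (at x))" by simp_all
  qed
  have "hausdorff_null s (\<Sigma> c)" if "c \<in> \<B>" for c
  proof -
    have c: "c \<in> \<A>" using that B(1) by blast
    show ?thesis unfolding \<Sigma>_def
      by (rule hausdorff_null_singular_perturbations[OF op[OF c] F2[OF c] assms(4) FV[OF c] gV dF(2)[OF c] assms(9)])
  qed
  hence "hausdorff_null s (\<Union>c\<in>\<B>. \<Sigma> c)" by (rule hausdorff_null_countable_Union[OF B(2)])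
  moreover have "matrix \<pi> \<in> (\<Union>c\<in>\<B>. \<Sigma> c)"
    if \<pi>: "linear \<pi>" "\<not> immersion \<A> (\<lambda>q. g (f q) + \<pi> (f q))" for \<pi> :: "real ^ 'm \<Rightarrow> real ^ 'l"
  proof (rule ccontr)
    \<comment> \<open>Outside all these sets the perturbed map has an injective derivative at every
      point in the charts of \<open>\<B>\<close>; the change of charts carries this to every chart
      of \<open>\<A>\<close>, a contradiction.\<close>
    assume notin: "matrix \<pi> \<notin> (\<Union>c\<in>\<B>. \<Sigma> c)"
    have "\<exists>D. ((\<lambda>q. g (f q) + \<pi> (f q)) \<circ> inv_into U \<phi> has_derivative D) (at (\<phi> q)) \<and> inj D"
      if U: "(U, \<phi>) \<in> \<A>" "q \<in> U" for U \<phi> q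
    proof -
      have "q \<in> (\<Union>c\<in>\<A>. fst c)" using U by (intro UN_I[OF U(1)]) simp
      hence "q \<in> (\<Union>c\<in>\<B>. fst c)" using assms(3) B(3) by (simp only: Cr_manifold_def)
      then obtain W \<psi> where W: "(W, \<psi>) \<in> \<B>" "q \<in> W" by (metis UN_E prod.collapse)
      let ?c = "(W, \<psi>)" and ?x = "\<psi> q"
      have c: "?c \<in> \<A>" and x: "?x \<in> snd ?c ` fst ?c" using W B(1) by auto
      let ?DF = "frechet_derivative (F ?c) (at ?x)"
      let ?Dg = "frechet_derivative g (at (F ?c ?x))"
      have dg: "(g has_derivative ?Dg) (at (F ?c ?x))"
        using gV FV[OF c] x by (auto simp: frechet_derivative_works numeral_2_eq_2)
      have "((\<lambda>y. g (F ?c y) + \<pi> (F ?c y)) has_derivative (\<lambda>v. ?Dg (?DF v) + \<pi> (?DF v))) (at ?x)"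
        using diff_chain_at[OF dF(1)[OF c x] dg]
          bounded_linear.has_derivative[OF linear_conv_bounded_linear[THEN iffD1, OF \<pi>(1)] dF(1)[OF c x]]
        by (intro has_derivative_add) (simp_all add: o_def)
      hence der: "((\<lambda>q. g (f q) + \<pi> (f q)) \<circ> inv_into W \<psi> has_derivative
          (\<lambda>v. ?Dg (?DF v) + \<pi> (?DF v))) (at ?x)"
        by (simp add: F_def o_def)
      have "?Dg (?DF v) + \<pi> (?DF v) \<noteq> 0" if "v \<noteq> 0" for v
      proof
        assume "?Dg (?DF v) + \<pi> (?DF v) = 0"
        hence "matrix \<pi> \<in> \<Sigma> ?c"
          unfolding \<Sigma>_def using that fun_cong[OF matrix_vector_mul(2)[OF \<pi>(1)]]
          by (intro CollectI bexI[OF _ x] exI[of _ v]) simp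
        thus False using notin W(1) by blast
      qed
      hence "inj (\<lambda>v. ?Dg (?DF v) + \<pi> (?DF v))"
        using linear_injective_0[OF has_derivative_linear[OF der]] by blast
      thus ?thesis
        using immersion_at_change_chart[OF assms(3) r U(1) c _ der] U(2) W(2) by blast
    qed
    thus False using \<pi>(2) by (auto simp: immersion_def)
  qed
  ultimately show "hausdorff_null s (matrix ` {\<pi> :: real ^ 'm \<Rightarrow> real ^ 'l.
              linear \<pi> \<and> \<not> immersion \<A> (\<lambda>q. g (f q) + \<pi> (f q))})"
    by (elim hausdorff_null_subset) auto
qed

end
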